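(* Let $(A,[~,\dots,~],a)$ be a Filippov algebroid of order $n$ over a smooth manifold $M$, with corresponding element $\varphi\in\mathrm{Der}^1(A)$, and let $\varphi_t=\varphi+\sum_{i=1}^kt^i\varphi_i$ be a deformation of $\varphi$ of order $k$. Then $\varphi_t$ extends to a deformation of order $k+1$ if and only if the cohomology class in $H^3_F(A)$ of the obstruction cocycle $\Theta_F=-\frac12\sum_{i+j=k+1;\,i,j>0}[\varphi_i,\varphi_j]$ vanishes.
   Context: Let $n\ge2$ be fixed, $M$ a smooth manifold, $\chi(M)$ the space of vector fields, $A\to M$ a smooth real vector bundle, $\Gamma A$ its space of smooth sections. A Filippov algebra of order $n$ is a real vector space $L$ with an $\mathbb R$-multilinear skew-symmetric bracket $[~,\dots,~]:L^{n}\to L$ satisfying $[a_1,\dots,a_{n-1},[b_1,\dots,b_n]]=\sum_{i=1}^n[b_1,\dots,b_{i-1},[a_1,\dots,a_{n-1},b_i],b_{i+1},\dots,b_n]$. A Filippov algebroid $(A,[~,\dots,~],a)$ of order $n$ over $M$ is a vector bundle $A$ with a Filippov algebra structure of order $n$ on $\Gamma A$ and a bundle map $a:\wedge^{n-1}A\to TM$ (the anchor) such that (a) $[a(x_1\wedge\cdots\wedge x_{n-1}),a(y_1\wedge\cdots\wedge y_{n-1})]=\sum_{i=1}^{n-1}a(y_1\wedge\cdots\wedge[x_1,\dots,x_{n-1},y_i]\wedge y_{i+1}\wedge\cdots\wedge y_{n-1})$, and (b) $[x_1,\dots,x_{n-1},fy]=f[x_1,\dots,x_{n-1},y]+a(x_1\wedge\cdots\wedge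 x_{n-1})(f)y$, for all $x_i,y_i,y\in\Gamma A$, $f\in C^\infty(M)$. Put $\mathcal L(A):=\Gamma A\wedge\cdots\wedge\Gamma A$ ($n-1$ copies); tensor and exterior powers are over $\mathbb R$; elements are written $X=X^1\wedge\cdots\wedge X^{n-1}$ (formulas extended linearly). For $p\ge1$, $\mathrm{Der}^p(A)$ (Filippov multiderivations of degree $p$) is the set of $\mathbb R$-multilinear maps $D:\otimes^{p-1}\mathcal L(A)\otimes(\mathcal L(A)\wedge\Gamma A)\to\Gamma A$, written $D(X_1,\dots,X_p,z)$ (so alternating in $X_p^1,\dots,X_p^{n-1},z$), for which there is a map $\sigma_D:\otimes^p\mathcal L(A)\to\chi(M)$ (the symbol), $C^\infty(M)$-multilinear in the sections $X_i^j$, with $D(X_1,\dots,X_p,fz)=fD(X_1,\dots,X_p,z)+\sigma_D(X_1,\dots,X_p)(f)z$. For $D_1\in\mathrm{Der}^p(A)$, $D_2\in\mathrm{Der}^q(A)$, with $Sh(k,q)$ the $(k,q)$-shuffles: for $0\le k\le p-1$, $$D_1\circ_k^\sigma D_2(X_1,\dots,X_{p+q},z)=(-1)^{kq}\sum_{s=1}^{n-1}D_1\big(X_{\sigma(1)},\dots,X_{\sigma(k)},\,X_{k+q+1}^1\wedge\cdots\wedge X_{k+q+1}^{s-1}\wedge D_2(X_{\sigma(k+1)},\dots,X_{\sigma(k+q)},X_{k+q+1}^s)\wedge X_{k+q+1}^{s+1}\wedge\cdots\wedge X_{k+q+1}^{n-1},\,X_{k+q+2},\dots,X_{p+q},z\big),$$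 and $D_1\circ_p^\sigma D_2(X_1,\dots,X_{p+q},z)=(-1)^{pq}D_1\big(X_{\sigma(1)},\dots,X_{\sigma(p)},D_2(X_{\sigma(p+1)},\dots,X_{\sigma(p+q)},z)\big)$; then $D_1\circ D_2=\sum_{k=0}^p\sum_{\sigma\in Sh(k,q)}\mathrm{sgn}(\sigma)D_1\circ_k^\sigma D_2$ and $[D_1,D_2]=(-1)^{pq}D_1\circ D_2-D_2\circ D_1\in\mathrm{Der}^{p+q}(A)$. The Filippov algebroid structure on $A$ corresponds to $\varphi\in\mathrm{Der}^1(A)$, $\varphi(x_1\wedge\cdots\wedge x_{n-1},y)=[x_1,\dots,x_{n-1},y]$, $\sigma_\varphi=a$, with $[\varphi,\varphi]=0$. Put $C^k_F(A)=\mathrm{Der}^{k-1}(A)$ and $\delta_F(\psi)=[\varphi,\psi]$; $H^3_F(A)$ is $\{\psi\in C^3_F(A):\delta_F\psi=0\}$ modulo $\delta_F(C^2_F(A))$. A deformation of order $k$ ($k\ge1$) of $\varphi$ is a family $\varphi_t=\varphi_0+\sum_{i=1}^kt^i\varphi_i$ with $\varphi_0=\varphi$, $\varphi_i\in\mathrm{Der}^1(A)$, such that $\sum_{i+j=r;\,i,j\ge0}[\varphi_i,\varphi_j]=0$ for $r=0,1,\dots,k$ (i.e. $[\varphi_t,\varphi_t]=0$ modulo $t^{k+1}$). It extends to a deformation of order $k+1$ if there is $\varphi_{k+1}\in C^2_F(A)$ such that $\varphi_t+t^{k+1}\varphi_{k+1}$ is a deformation of order $k+1$. The cochain $\Theta_F\in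 C^3_F(A)$ is a $3$-cocycle. *)

theory Defs
  imports
    "HOL-Analysis.Analysis"
    "HOL-Algebra.Coset"
    "HOL-Combinatorics.Permutations"
    "HOL-Library.Function_Algebras"
begin

text \<open>
  Functions into a real vector space form a real vector space pointwise; the additive part of this
  instance is \<^theory>\<open>HOL-Library.Function_Algebras\<close>. Sections, tangent vectors, vector fields and
  cochains are all functions and are added and scaled through this instance.
\<close>

instantiation "fun" :: (type, real_vector) real_vector
begin

definition scaleR_fun_def: "scaleR c f = (\<lambda>x. c *\<^sub>R f x)"

instance
  by standard (simp_all add: scaleR_fun_def fun_eq_iff scaleR_add_left scaleR_add_right)

end


section \<open>Smooth manifolds and smooth vector bundles\<close>

text \<open>\<open>S\<close> is meant to be open and \<^typ>\<open>'a\<close> finite-dimensional.\<close>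

fun k_smooth_on :: "nat \<Rightarrow> 'a::real_normed_vector set \<Rightarrow> ('a \<Rightarrow> 'b::real_normed_vector) \<Rightarrow> bool" where
  "k_smooth_on 0 S f \<longleftrightarrow> continuous_on S f"
| "k_smooth_on (Suc k) S f \<longleftrightarrow>
     (\<forall>x\<in>S. f differentiable (at x)) \<and>
     (\<forall>v. k_smooth_on k S (\<lambda>x. frechet_derivative f (at x) v))"

definition smooth_on :: "'a::real_normed_vector set \<Rightarrow> ('a \<Rightarrow> 'b::real_normed_vector) \<Rightarrow> bool" where
  "smooth_on S f \<longleftrightarrow> (\<forall>k. k_smooth_on k S f)"

definition finite_dim :: "'a::real_vector itself \<Rightarrow> bool" where
  "finite_dim _ \<longleftrightarrow> (\<exists>B::'a set. finite B \<and> span B = UNIV)"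

text \<open>
  A vector bundle over the manifold whose underlying space is the type \<^typ>\<open>'m\<close>. Charts are pairs
  \<open>(U, c)\<close> of a domain and a map into the model space \<^typ>\<open>'e\<close>. The fibres are subspaces of one
  real vector space \<^typ>\<open>'v\<close>; this is no restriction, as every family of vector spaces embeds into its
  direct sum. A local trivialization is a pair \<open>(U, h)\<close> where \<open>h m\<close>, for \<open>m \<in> U\<close>, maps the fibre at
  \<open>m\<close> isomorphically onto the model fibre \<^typ>\<open>'r\<close>. The total space is \<open>SIGMA m:UNIV. fibre E m\<close>, with
  the topology and smooth structure determined by the trivializations. The model spaces are only
  required to be finite-dimensional, so that dimension and rank 0 are included.
\<close>

record ('m, 'e, 'v, 'r) vector_bundle =
  atlas :: "('m set \<times> ('m \<Rightarrow> 'e)) set"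
  fibre :: "'m \<Rightarrow> 'v set"
  trivs :: "('m set \<times> ('m \<Rightarrow> 'v \<Rightarrow> 'r)) set"

definition smooth_atlas ::
  "('m::{t2_space,second_countable_topology} set \<times> ('m \<Rightarrow> 'e::real_normed_vector)) set \<Rightarrow> bool" where
  "smooth_atlas \<A> \<longleftrightarrow>
     finite_dim TYPE('e) \<and>
     (\<Union>(U, c)\<in>\<A>. U) = UNIV \<and>
     (\<forall>(U, c)\<in>\<A>. open U \<and> open (c ` U) \<and> homeomorphism U (c ` U) c (inv_into U c)) \<and>
     (\<forall>(U, c)\<in>\<A>. \<forall>(V, d)\<in>\<A>. smooth_on (c ` (U \<inter> V)) (d \<circ> inv_into U c))"

definition smooth_mfd_on ::
  "('m set \<times> ('m \<Rightarrow> 'e::real_normed_vector)) set \<Rightarrow> 'm set \<Rightarrow> ('m \<Rightarrow> 'b::real_normed_vector) \<Rightarrow> bool" where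
  "smooth_mfd_on \<A> W g \<longleftrightarrow> (\<forall>(U, c)\<in>\<A>. smooth_on (c ` (U \<inter> W)) (g \<circ> inv_into U c))"

definition smooth_vector_bundle ::
  "('m::{t2_space,second_countable_topology}, 'e::real_normed_vector,
    'v::real_vector, 'r::real_normed_vector) vector_bundle \<Rightarrow> bool" where
  "smooth_vector_bundle E \<longleftrightarrow>
     smooth_atlas (atlas E) \<and>
     finite_dim TYPE('r) \<and>
     (\<forall>m. subspace (fibre E m)) \<and>
     (\<Union>(U, h)\<in>trivs E. U) = UNIV \<and>
     (\<forall>(U, h)\<in>trivs E. open U \<and>
        (\<forall>m\<in>U. bij_betw (h m) (fibre E m) UNIV \<and>
          (\<forall>x\<in>fibre E m. \<forall>y\<in>fibre E m. \<forall>a b. h m (a *\<^sub>R x + b *\<^sub>R y) = a *\<^sub>R h m x + b *\<^sub>R h m y))) \<and>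
     (\<forall>(U, h)\<in>trivs E. \<forall>(V, g)\<in>trivs E. \<forall>w.
        smooth_mfd_on (atlas E) (U \<inter> V) (\<lambda>m. g m (inv_into (fibre E m) (h m) w)))"

definition smooth_functions ::
  "('m, 'e::real_normed_vector, 'v, 'r) vector_bundle \<Rightarrow> ('m \<Rightarrow> real) set" where
  "smooth_functions E = {f. smooth_mfd_on (atlas E) UNIV f}"

definition smooth_sections ::
  "('m, 'e::real_normed_vector, 'v, 'r::real_normed_vector) vector_bundle \<Rightarrow> ('m \<Rightarrow> 'v) set" where
  "smooth_sections E =
     {s. (\<forall>m. s m \<in> fibre E m) \<and> (\<forall>(U, h)\<in>trivs E. smooth_mfd_on (atlas E) U (\<lambda>m. h m (s m)))}"

text \<open>
  Tangent vectors at \<open>m\<close> are derivations at \<open>m\<close> of the algebra of smooth functions, extended by 0 to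
  all functions, and a vector field is a map \<open>X\<close> on points; the function obtained by applying it to
  \<open>f\<close> is \<open>\<lambda>m. X m f\<close>.
\<close>

definition tangent_space ::
  "('m, 'e::real_normed_vector, 'v, 'r) vector_bundle \<Rightarrow> 'm \<Rightarrow> (('m \<Rightarrow> real) \<Rightarrow> real) set" where
  "tangent_space E m =
     {v. (\<forall>f\<in>smooth_functions E. \<forall>g\<in>smooth_functions E.
            (\<forall>a b. v (a *\<^sub>R f + b *\<^sub>R g) = a * v f + b * v g) \<and> v (f * g) = f m * v g + g m * v f) \<and>
         (\<forall>f. f \<notin> smooth_functions E \<longrightarrow> v f = 0)}"

definition vector_fields ::
  "('m, 'e::real_normed_vector, 'v, 'r) vector_bundle \<Rightarrow> ('m \<Rightarrow> ('m \<Rightarrow> real) \<Rightarrow> real) set" where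
  "vector_fields E =
     {X. (\<forall>m. X m \<in> tangent_space E m) \<and> (\<forall>f\<in>smooth_functions E. (\<lambda>m. X m f) \<in> smooth_functions E)}"

definition lie_bracket ::
  "('m, 'e::real_normed_vector, 'v, 'r) vector_bundle \<Rightarrow>
   ('m \<Rightarrow> ('m \<Rightarrow> real) \<Rightarrow> real) \<Rightarrow> ('m \<Rightarrow> ('m \<Rightarrow> real) \<Rightarrow> real) \<Rightarrow> 'm \<Rightarrow> ('m \<Rightarrow> real) \<Rightarrow> real" where
  "lie_bracket E X Y = (\<lambda>m f. if f \<in> smooth_functions E
     then X m (\<lambda>q. Y q f) - Y m (\<lambda>q. X q f) else 0)"

text \<open>The action of functions on sections and, with \<open>'w\<close> a space of tangent vectors, on vector fields.\<close>

definition fscale :: "('m \<Rightarrow> real) \<Rightarrow> ('m \<Rightarrow> 'w::real_vector) \<Rightarrow> 'm \<Rightarrow> 'w" (infixr \<open>\<cdot>\<^sub>F\<close> 75) where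
  "f \<cdot>\<^sub>F s = (\<lambda>m. f m *\<^sub>R s m)"


section \<open>Filippov algebroids\<close>

text \<open>
  Maps of \<open>N\<close> arguments are maps on lists of length \<open>N\<close>, and a linear map on the \<open>N\<close>-th exterior power
  of \<open>L\<close> is an alternating multilinear map of \<open>N\<close> arguments in \<open>L\<close>. Over the reals, alternating and
  skew-symmetric are the same for multilinear maps.
\<close>

definition alternating_multilinear_on ::
  "'a::real_vector set \<Rightarrow> nat \<Rightarrow> ('a list \<Rightarrow> 'b::real_vector) \<Rightarrow> bool" where
  "alternating_multilinear_on L N F \<longleftrightarrow>
     (\<forall>xs. length xs = N \<and> set xs \<subseteq> L \<longrightarrow>
        (\<forall>j<N. \<forall>x\<in>L. \<forall>y\<in>L. \<forall>a b.
           F (xs[j := a *\<^sub>R x + b *\<^sub>R y]) = a *\<^sub>R F (xs[j := x]) + b *\<^sub>R F (xs[j := y])) \<and>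
        (\<forall>i<N. \<forall>j<N. i \<noteq> j \<and> xs ! i = xs ! j \<longrightarrow> F xs = 0))"

definition filippov_algebra_on ::
  "nat \<Rightarrow> 'a::real_vector set \<Rightarrow> ('a list \<Rightarrow> 'a) \<Rightarrow> bool" where
  "filippov_algebra_on n L br \<longleftrightarrow>
     subspace L \<and>
     (\<forall>xs. length xs = n \<and> set xs \<subseteq> L \<longrightarrow> br xs \<in> L) \<and>
     alternating_multilinear_on L n br \<and>
     (\<forall>as bs. length as = n - 1 \<and> set as \<subseteq> L \<and> length bs = n \<and> set bs \<subseteq> L \<longrightarrow>
        br (as @ [br bs]) = (\<Sum>i<n. br (bs[i := br (as @ [bs ! i])])))"

text \<open>A bundle map \<open>a\<close> is given fibrewise; \<open>on_sections a\<close> is the induced map on sections.\<close>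

definition on_sections :: "('m \<Rightarrow> 'v list \<Rightarrow> 'w) \<Rightarrow> ('m \<Rightarrow> 'v) list \<Rightarrow> 'm \<Rightarrow> 'w" where
  "on_sections a xs = (\<lambda>m. a m (map (\<lambda>x. x m) xs))"

definition is_anchor ::
  "nat \<Rightarrow> ('m, 'e::real_normed_vector, 'v::real_vector, 'r::real_normed_vector) vector_bundle \<Rightarrow>
   ('m \<Rightarrow> 'v list \<Rightarrow> ('m \<Rightarrow> real) \<Rightarrow> real) \<Rightarrow> bool" where
  "is_anchor n E a \<longleftrightarrow>
     (\<forall>m. alternating_multilinear_on (fibre E m) (n - 1) (a m) \<and>
          (\<forall>vs. length vs = n - 1 \<and> set vs \<subseteq> fibre E m \<longrightarrow> a m vs \<in> tangent_space E m)) \<and>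
     (\<forall>xs. length xs = n - 1 \<and> set xs \<subseteq> smooth_sections E \<longrightarrow> on_sections a xs \<in> vector_fields E)"

definition filippov_algebroid ::
  "nat \<Rightarrow> ('m, 'e::real_normed_vector, 'v::real_vector, 'r::real_normed_vector) vector_bundle \<Rightarrow>
   (('m \<Rightarrow> 'v) list \<Rightarrow> ('m \<Rightarrow> 'v)) \<Rightarrow> ('m \<Rightarrow> 'v list \<Rightarrow> ('m \<Rightarrow> real) \<Rightarrow> real) \<Rightarrow> bool" where
  "filippov_algebroid n E br a \<longleftrightarrow>
     filippov_algebra_on n (smooth_sections E) br \<and>
     is_anchor n E a \<and>
     (\<forall>xs ys. length xs = n - 1 \<and> set xs \<subseteq> smooth_sections E \<and>
              length ys = n - 1 \<and> set ys \<subseteq> smooth_sections E \<longrightarrow>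
        lie_bracket E (on_sections a xs) (on_sections a ys)
          = (\<Sum>i<n-1. on_sections a (ys[i := br (xs @ [ys ! i])]))) \<and>
     (\<forall>xs. \<forall>y\<in>smooth_sections E. \<forall>f\<in>smooth_functions E.
        length xs = n - 1 \<and> set xs \<subseteq> smooth_sections E \<longrightarrow>
        br (xs @ [f \<cdot>\<^sub>F y]) = f \<cdot>\<^sub>F br (xs @ [y]) + (\<lambda>m. on_sections a xs m f) \<cdot>\<^sub>F y)"


section \<open>Filippov multiderivations and their bracket\<close>

text \<open>
  A map on \<open>\<otimes>\<^sup>p\<^sup>-\<^sup>1 \<L>(A) \<otimes> (\<L>(A) \<and> \<Gamma>A)\<close> is determined by its values on decomposable elements. It takes a
  list \<open>Xs\<close> of \<open>p\<close> blocks, each a list of \<open>n - 1\<close> sections, and one more section \<open>z\<close>. So that such a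
  map is determined by its values on these arguments, it is required to be 0 on all others. Lists
  count from 0: \<open>X\<^sub>i\<^sup>j\<close> is \<open>Xs ! (i - 1) ! (j - 1)\<close>.
\<close>

type_synonym ('m, 'v) cochain = "('m \<Rightarrow> 'v) list list \<Rightarrow> ('m \<Rightarrow> 'v) \<Rightarrow> ('m \<Rightarrow> 'v)"

definition blocks ::
  "nat \<Rightarrow> ('m, 'e::real_normed_vector, 'v, 'r::real_normed_vector) vector_bundle \<Rightarrow> nat
   \<Rightarrow> ('m \<Rightarrow> 'v) list list set" where
  "blocks n E p = {Xs. length Xs = p \<and> (\<forall>X\<in>set Xs. length X = n - 1 \<and> set X \<subseteq> smooth_sections E)}"

definition is_symbol ::
  "nat \<Rightarrow> ('m, 'e::real_normed_vector, 'v::real_vector, 'r::real_normed_vector) vector_bundle \<Rightarrow> nat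
   \<Rightarrow> ('m, 'v) cochain \<Rightarrow> (('m \<Rightarrow> 'v) list list \<Rightarrow> 'm \<Rightarrow> ('m \<Rightarrow> real) \<Rightarrow> real) \<Rightarrow> bool" where
  "is_symbol n E p D S \<longleftrightarrow>
     (\<forall>Xs\<in>blocks n E p.
        S Xs \<in> vector_fields E \<and>
        (\<forall>i<p. alternating_multilinear_on (smooth_sections E) (n - 1) (\<lambda>X. S (Xs[i := X]))) \<and>
        (\<forall>i<p. \<forall>j<n-1. \<forall>x\<in>smooth_sections E. \<forall>y\<in>smooth_sections E.
           \<forall>f\<in>smooth_functions E. \<forall>g\<in>smooth_functions E.
           S (Xs[i := (Xs ! i)[j := f \<cdot>\<^sub>F x + g \<cdot>\<^sub>F y]])
             = f \<cdot>\<^sub>F S (Xs[i := (Xs ! i)[j := x]]) + g \<cdot>\<^sub>F S (Xs[i := (Xs ! i)[j := y]])) \<and>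
        (\<forall>z\<in>smooth_sections E. \<forall>f\<in>smooth_functions E.
           D Xs (f \<cdot>\<^sub>F z) = f \<cdot>\<^sub>F D Xs z + (\<lambda>m. S Xs m f) \<cdot>\<^sub>F z))"

definition Der ::
  "nat \<Rightarrow> ('m, 'e::real_normed_vector, 'v::real_vector, 'r::real_normed_vector) vector_bundle \<Rightarrow> nat
   \<Rightarrow> ('m, 'v) cochain set" where
  "Der n E p = {D.
     (\<forall>Xs z. \<not> (Xs \<in> blocks n E p \<and> z \<in> smooth_sections E) \<longrightarrow> D Xs z = 0) \<and>
     (\<forall>Xs\<in>blocks n E p. \<forall>z\<in>smooth_sections E.
        D Xs z \<in> smooth_sections E \<and>
        (\<forall>i<p. alternating_multilinear_on (smooth_sections E) (n - 1) (\<lambda>X. D (Xs[i := X]) z)) \<and>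
        alternating_multilinear_on (smooth_sections E) n
          (\<lambda>ys. D (Xs[p - 1 := butlast ys]) (last ys))) \<and>
     (\<exists>S. is_symbol n E p D S)}"

text \<open>Shuffles, as permutations of \<open>{0..<k+q}\<close>.\<close>

definition Sh :: "nat \<Rightarrow> nat \<Rightarrow> (nat \<Rightarrow> nat) set" where
  "Sh k q = {\<sigma>. \<sigma> permutes {..<k + q} \<and> strict_mono_on {..<k} \<sigma> \<and> strict_mono_on {k..<k + q} \<sigma>}"

definition comp_at ::
  "nat \<Rightarrow> nat \<Rightarrow> nat \<Rightarrow> nat \<Rightarrow> (nat \<Rightarrow> nat)
   \<Rightarrow> ('m, 'v::real_vector) cochain \<Rightarrow> ('m, 'v) cochain \<Rightarrow> ('m, 'v) cochain" where
  "comp_at n p q k \<sigma> D1 D2 Xs z =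
     (let front = map (\<lambda>i. Xs ! \<sigma> i) [0..<k];
          inner = map (\<lambda>i. Xs ! \<sigma> i) [k..<k + q]
      in if k < p
         then (-1) ^ (k * q) *\<^sub>R
           (\<Sum>s<n-1. D1 (front @ [(Xs ! (k + q))[s := D2 inner (Xs ! (k + q) ! s)]] @ drop (k + q + 1) Xs) z)
         else (-1) ^ (p * q) *\<^sub>R D1 front (D2 inner z))"

definition circ ::
  "nat \<Rightarrow> ('m, 'e::real_normed_vector, 'v::real_vector, 'r::real_normed_vector) vector_bundle \<Rightarrow> nat \<Rightarrow> nat
   \<Rightarrow> ('m, 'v) cochain \<Rightarrow> ('m, 'v) cochain \<Rightarrow> ('m, 'v) cochain" where
  "circ n E p q D1 D2 Xs z =
     (if Xs \<in> blocks n E (p + q) \<and> z \<in> smooth_sections E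
      then \<Sum>k\<le>p. \<Sum>\<sigma>\<in>Sh k q. of_int (sign \<sigma>) *\<^sub>R comp_at n p q k \<sigma> D1 D2 Xs z
      else 0)"

text \<open>The degrees \<open>p\<close>, \<open>q\<close> of \<open>D1\<close>, \<open>D2\<close> are arguments, since they cannot be read off from the maps.\<close>

definition der_bracket ::
  "nat \<Rightarrow> ('m, 'e::real_normed_vector, 'v::real_vector, 'r::real_normed_vector) vector_bundle \<Rightarrow> nat \<Rightarrow> nat
   \<Rightarrow> ('m, 'v) cochain \<Rightarrow> ('m, 'v) cochain \<Rightarrow> ('m, 'v) cochain" where
  "der_bracket n E p q D1 D2 = (-1) ^ (p * q) *\<^sub>R circ n E p q D1 D2 - circ n E q p D2 D1"


section \<open>Cohomology and deformations\<close>

definition structure_cochain ::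
  "nat \<Rightarrow> ('m, 'e::real_normed_vector, 'v::real_vector, 'r::real_normed_vector) vector_bundle
   \<Rightarrow> (('m \<Rightarrow> 'v) list \<Rightarrow> ('m \<Rightarrow> 'v)) \<Rightarrow> ('m, 'v) cochain" where
  "structure_cochain n E br Xs z =
     (if Xs \<in> blocks n E 1 \<and> z \<in> smooth_sections E then br (hd Xs @ [z]) else 0)"

definition C_F ::
  "nat \<Rightarrow> ('m, 'e::real_normed_vector, 'v::real_vector, 'r::real_normed_vector) vector_bundle \<Rightarrow> nat
   \<Rightarrow> ('m, 'v) cochain set" where
  "C_F n E k = Der n E (k - 1)"

definition delta_F ::
  "nat \<Rightarrow> ('m, 'e::real_normed_vector, 'v::real_vector, 'r::real_normed_vector) vector_bundle
   \<Rightarrow> ('m, 'v) cochain \<Rightarrow> nat \<Rightarrow> ('m, 'v) cochain \<Rightarrow> ('m, 'v) cochain" where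
  "delta_F n E \<phi> k \<psi> = der_bracket n E 1 (k - 1) \<phi> \<psi>"

text \<open>
  The cocycles and coboundaries of degree \<open>k\<close> (\<open>k \<ge> 3\<close> for coboundaries), and their quotient. The class
  of a cocycle is its coset modulo the coboundaries. The coset of \<open>\<psi>\<close> is formed by adding \<open>\<psi>\<close> to every
  coboundary, in the space of all functions of type \<^typ>\<open>('m, 'v) cochain\<close>, and makes sense without
  assuming that \<open>\<psi>\<close> or the coboundaries satisfy the conditions in \<open>Der\<close>.
\<close>

definition cocycles ::
  "nat \<Rightarrow> ('m, 'e::real_normed_vector, 'v::real_vector, 'r::real_normed_vector) vector_bundle
   \<Rightarrow> ('m, 'v) cochain \<Rightarrow> nat \<Rightarrow> ('m, 'v) cochain monoid" where
  "cocycles n E \<phi> k = \<lparr>carrier = {\<psi> \<in> C_F n E k. delta_F n E \<phi> k \<psi> = 0}, mult = (+), one = 0\<rparr>"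

definition coboundaries ::
  "nat \<Rightarrow> ('m, 'e::real_normed_vector, 'v::real_vector, 'r::real_normed_vector) vector_bundle
   \<Rightarrow> ('m, 'v) cochain \<Rightarrow> nat \<Rightarrow> ('m, 'v) cochain set" where
  "coboundaries n E \<phi> k = delta_F n E \<phi> (k - 1) ` C_F n E (k - 1)"

definition H_F ::
  "nat \<Rightarrow> ('m, 'e::real_normed_vector, 'v::real_vector, 'r::real_normed_vector) vector_bundle
   \<Rightarrow> ('m, 'v) cochain \<Rightarrow> nat \<Rightarrow> ('m, 'v) cochain set monoid" where
  "H_F n E \<phi> k = cocycles n E \<phi> k Mod coboundaries n E \<phi> k"

definition cohomology_class ::
  "nat \<Rightarrow> ('m, 'e::real_normed_vector, 'v::real_vector, 'r::real_normed_vector) vector_bundle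
   \<Rightarrow> ('m, 'v) cochain \<Rightarrow> nat \<Rightarrow> ('m, 'v) cochain \<Rightarrow> ('m, 'v) cochain set" where
  "cohomology_class n E \<phi> k \<psi> = coboundaries n E \<phi> k #>\<^bsub>cocycles n E \<phi> k\<^esub> \<psi>"

text \<open>
  A family \<open>\<phi>\<^sub>t = \<phi>\<^sub>0 + \<Sum>i=1..k. t\<^sup>i \<phi>\<^sub>i\<close> is represented by its coefficients \<open>\<Phi> 0, \<dots>, \<Phi> k\<close>; the values
  \<open>\<Phi> i\<close> for \<open>i > k\<close> are irrelevant.
\<close>

definition deformation ::
  "nat \<Rightarrow> ('m, 'e::real_normed_vector, 'v::real_vector, 'r::real_normed_vector) vector_bundle
   \<Rightarrow> ('m, 'v) cochain \<Rightarrow> nat \<Rightarrow> (nat \<Rightarrow> ('m, 'v) cochain) \<Rightarrow> bool" where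
  "deformation n E \<phi> k \<Phi> \<longleftrightarrow>
     k \<ge> 1 \<and> \<Phi> 0 = \<phi> \<and> (\<forall>i\<le>k. \<Phi> i \<in> Der n E 1) \<and>
     (\<forall>r\<le>k. (\<Sum>(i, j)\<in>{(i, j). i + j = r}. der_bracket n E 1 1 (\<Phi> i) (\<Phi> j)) = 0)"

definition extends_deformation ::
  "nat \<Rightarrow> ('m, 'e::real_normed_vector, 'v::real_vector, 'r::real_normed_vector) vector_bundle
   \<Rightarrow> ('m, 'v) cochain \<Rightarrow> nat \<Rightarrow> (nat \<Rightarrow> ('m, 'v) cochain) \<Rightarrow> bool" where
  "extends_deformation n E \<phi> k \<Phi> \<longleftrightarrow>
     (\<exists>\<psi>\<in>C_F n E 2. deformation n E \<phi> (k + 1) (\<Phi>(k + 1 := \<psi>)))"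

definition Theta_F ::
  "nat \<Rightarrow> ('m, 'e::real_normed_vector, 'v::real_vector, 'r::real_normed_vector) vector_bundle
   \<Rightarrow> nat \<Rightarrow> (nat \<Rightarrow> ('m, 'v) cochain) \<Rightarrow> ('m, 'v) cochain" where
  "Theta_F n E k \<Phi> =
     - (1/2) *\<^sub>R (\<Sum>(i, j)\<in>{(i, j). i + j = k + 1 \<and> i > 0 \<and> j > 0}. der_bracket n E 1 1 (\<Phi> i) (\<Phi> j))"

end

theory Submission
  imports Defs
begin

text \<open>
  In degree 1 the bracket is symmetric, so the coefficient of \<open>t\<^sup>k\<^sup>+\<^sup>1\<close> in the bracket of
  \<open>\<phi>\<^sub>t + t\<^sup>k\<^sup>+\<^sup>1 \<psi>\<close> with itself is \<open>2 [\<phi>, \<psi>] - 2 \<Theta>\<close>. Hence the extensions are exactly the \<open>\<psi>\<close> whose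
  coboundary is \<open>\<Theta>\<close>. As the coboundaries form a subspace of the space of all maps, the coset of
  \<open>\<Theta>\<close> is trivial if and only if \<open>\<Theta>\<close> is a coboundary.
\<close>

section \<open>Linear combinations of smooth functions and vector fields\<close>

text \<open>As \<open>S\<close> is open, the full derivative at a point of \<open>S\<close> depends
  only on the values on \<open>S\<close>. This allows the derivative of a sum to be replaced by the
  sum of the derivatives, an equation known only at points of \<open>S\<close>.\<close>

lemma k_smooth_on_cong_open:
  assumes "open S" "\<And>x. x \<in> S \<Longrightarrow> f x = g x" "k_smooth_on k S f"
  shows "k_smooth_on k S g"
  using assms(2,3)
proof (induction k arbitrary: f g)
  case 0
  then show ?case
    by (simp cong: continuous_on_cong)
next
  case (Suc k)
  have deriv: "(g has_derivative frechet_derivative f (at x)) (at x)" if "x \<in> S" for x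
  proof (rule has_derivative_transform_within_open[OF _ \<open>open S\<close> that])
    show "(f has_derivative frechet_derivative f (at x)) (at x)"
      using Suc.prems(2) that by (simp add: frechet_derivative_works)
  qed (use Suc.prems(1) in auto)
  have "k_smooth_on k S (\<lambda>x. frechet_derivative g (at x) v)" for v
  proof (rule Suc.IH)
    show "frechet_derivative f (at x) v = frechet_derivative g (at x) v" if "x \<in> S" for x
      using frechet_derivative_at[OF deriv[OF that]] by simp
    show "k_smooth_on k S (\<lambda>x. frechet_derivative f (at x) v)"
      using Suc.prems(2) by simp
  qed
  then show ?case
    using deriv by (auto simp: differentiable_def)
qed

lemma k_smooth_on_linear_combination:
  assumes "open S" "k_smooth_on k S f" "k_smooth_on k S g"
  shows "k_smooth_on k S (\<lambda>x. a *\<^sub>R f x + b *\<^sub>R g x)"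
  using assms(2,3)
proof (induction k arbitrary: f g)
  case 0
  then show ?case
    by (auto intro!: continuous_intros)
next
  case (Suc k)
  let ?h = "\<lambda>x. a *\<^sub>R f x + b *\<^sub>R g x"
  let ?d = "\<lambda>x v. a *\<^sub>R frechet_derivative f (at x) v + b *\<^sub>R frechet_derivative g (at x) v"
  have deriv: "(?h has_derivative ?d x) (at x)" if "x \<in> S" for x
    using Suc.prems that
    by (intro derivative_intros) (simp_all add: frechet_derivative_works)
  have "k_smooth_on k S (\<lambda>x. frechet_derivative ?h (at x) v)" for v
  proof (rule k_smooth_on_cong_open[OF \<open>open S\<close>])
    show "?d x v = frechet_derivative ?h (at x) v" if "x \<in> S" for x
      using frechet_derivative_at[OF deriv[OF that]] by metis
    show "k_smooth_on k S (\<lambda>x. ?d x v)"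
      using Suc.prems by (intro Suc.IH) simp_all
  qed
  then show ?case
    using deriv by (auto simp: differentiable_def)
qed

lemma smooth_functions_linear_combination:
  assumes "smooth_atlas (atlas E)" "f \<in> smooth_functions E" "g \<in> smooth_functions E"
  shows "(\<lambda>m. a * f m + b * g m) \<in> smooth_functions E"
proof -
  have "k_smooth_on k (c ` U) (\<lambda>x. a * f (inv_into U c x) + b * g (inv_into U c x))"
    if "(U, c) \<in> atlas E" for U c k
  proof -
    have "open (c ` U)"
      using assms(1) that by (auto simp: smooth_atlas_def)
    moreover have "k_smooth_on k (c ` U) (f \<circ> inv_into U c)" "k_smooth_on k (c ` U) (g \<circ> inv_into U c)"
      using assms(2,3) that by (auto simp: smooth_functions_def smooth_mfd_on_def smooth_on_def)
    ultimately show ?thesis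
      using k_smooth_on_linear_combination[of "c ` U" k "f \<circ> inv_into U c" "g \<circ> inv_into U c" a b]
      by simp
  qed
  then show ?thesis
    by (auto simp: smooth_functions_def smooth_mfd_on_def smooth_on_def o_def)
qed

lemma vector_fields_linear_combination:
  assumes "smooth_atlas (atlas E)" "X \<in> vector_fields E" "Y \<in> vector_fields E"
  shows "a *\<^sub>R X + b *\<^sub>R Y \<in> vector_fields E"
proof -
  have "a *\<^sub>R X m + b *\<^sub>R Y m \<in> tangent_space E m" for m
  proof -
    have "X m \<in> tangent_space E m" "Y m \<in> tangent_space E m"
      using assms(2,3) by (auto simp: vector_fields_def)
    then show ?thesis
      by (simp add: tangent_space_def scaleR_fun_def algebra_simps)
  qed
  moreover have "(\<lambda>m. a * X m f + b * Y m f) \<in> smooth_functions E" if "f \<in> smooth_functions E" for f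
    using assms that
    by (intro smooth_functions_linear_combination) (auto simp: vector_fields_def)
  ultimately show ?thesis
    by (simp add: vector_fields_def scaleR_fun_def)
qed

section \<open>Linear combinations of multiderivations\<close>

lemma alternating_multilinear_on_linear_combination:
  assumes "alternating_multilinear_on L N F" "alternating_multilinear_on L N G"
  shows "alternating_multilinear_on L N (\<lambda>xs. a *\<^sub>R F xs + b *\<^sub>R G xs)"
  using assms unfolding alternating_multilinear_on_def
  by (simp add: algebra_simps)

text \<open>Each equation defining a symbol is linear in the pair of a map and its symbol, so
  symbols may be combined with the same coefficients. The atlas enters through the values, which
  have to be vector fields again.\<close>

lemma is_symbol_linear_combination:
  assumes "smooth_atlas (atlas E)" "is_symbol n E p D S" "is_symbol n E p D' S'"
  shows "is_symbol n E p (a *\<^sub>R D + b *\<^sub>R D') (a *\<^sub>R S + b *\<^sub>R S')"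
  unfolding is_symbol_def
proof (intro ballI conjI allI impI)
  fix Xs assume Xs: "Xs \<in> blocks n E p"
  note S = assms(2)[unfolded is_symbol_def, rule_format, OF Xs]
  note S' = assms(3)[unfolded is_symbol_def, rule_format, OF Xs]
  show "(a *\<^sub>R S + b *\<^sub>R S') Xs \<in> vector_fields E"
    using vector_fields_linear_combination[OF assms(1), of "S Xs" "S' Xs" a b] S S'
    by (simp add: scaleR_fun_def)
  show "alternating_multilinear_on (smooth_sections E) (n - 1) (\<lambda>X. (a *\<^sub>R S + b *\<^sub>R S') (Xs[i := X]))"
    if "i < p" for i
    using alternating_multilinear_on_linear_combination[of "smooth_sections E" "n - 1"
        "\<lambda>X. S (Xs[i := X])" "\<lambda>X. S' (Xs[i := X])" a b] S S' that
    by (simp add: scaleR_fun_def)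
  show "(a *\<^sub>R S + b *\<^sub>R S') (Xs[i := (Xs ! i)[j := f \<cdot>\<^sub>F x + g \<cdot>\<^sub>F y]]) =
      f \<cdot>\<^sub>F (a *\<^sub>R S + b *\<^sub>R S') (Xs[i := (Xs ! i)[j := x]]) +
      g \<cdot>\<^sub>F (a *\<^sub>R S + b *\<^sub>R S') (Xs[i := (Xs ! i)[j := y]])"
    if "i < p" "j < n - 1" "x \<in> smooth_sections E" "y \<in> smooth_sections E"
      "f \<in> smooth_functions E" "g \<in> smooth_functions E" for i j x y f g
  proof -
    have "S (Xs[i := (Xs ! i)[j := f \<cdot>\<^sub>F x + g \<cdot>\<^sub>F y]]) =
        f \<cdot>\<^sub>F S (Xs[i := (Xs ! i)[j := x]]) + g \<cdot>\<^sub>F S (Xs[i := (Xs ! i)[j := y]])"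
      "S' (Xs[i := (Xs ! i)[j := f \<cdot>\<^sub>F x + g \<cdot>\<^sub>F y]]) =
        f \<cdot>\<^sub>F S' (Xs[i := (Xs ! i)[j := x]]) + g \<cdot>\<^sub>F S' (Xs[i := (Xs ! i)[j := y]])"
      using S S' that by blast+
    then show ?thesis
      by (simp add: scaleR_fun_def fscale_def fun_eq_iff algebra_simps)
  qed
  show "(a *\<^sub>R D + b *\<^sub>R D') Xs (f \<cdot>\<^sub>F z) =
      f \<cdot>\<^sub>F (a *\<^sub>R D + b *\<^sub>R D') Xs z + (\<lambda>m. (a *\<^sub>R S + b *\<^sub>R S') Xs m f) \<cdot>\<^sub>F z"
    if "z \<in> smooth_sections E" "f \<in> smooth_functions E" for z f
  proof -
    have "D Xs (f \<cdot>\<^sub>F z) = f \<cdot>\<^sub>F D Xs z + (\<lambda>m. S Xs m f) \<cdot>\<^sub>F z"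
      "D' Xs (f \<cdot>\<^sub>F z) = f \<cdot>\<^sub>F D' Xs z + (\<lambda>m. S' Xs m f) \<cdot>\<^sub>F z"
      using S S' that by blast+
    then show ?thesis
      by (simp add: scaleR_fun_def fscale_def fun_eq_iff algebra_simps)
  qed
qed

text \<open>Makes the cochains closed under combinations, so that a combination of coboundaries
  again has a cochain as preimage.\<close>

lemma Der_linear_combination:
  assumes "smooth_atlas (atlas E)" "subspace (smooth_sections E)"
    and D: "D \<in> Der n E p" and D': "D' \<in> Der n E p"
  shows "a *\<^sub>R D + b *\<^sub>R D' \<in> Der n E p"
proof -
  have "\<exists>S. is_symbol n E p (a *\<^sub>R D + b *\<^sub>R D') S"
    using is_symbol_linear_combination[OF assms(1)] D D' unfolding Der_def by blast
  moreover have "(a *\<^sub>R D + b *\<^sub>R D') Xs z = 0"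
    if "\<not> (Xs \<in> blocks n E p \<and> z \<in> smooth_sections E)" for Xs z
  proof -
    have "D Xs z = 0" "D' Xs z = 0"
      using D D' that unfolding Der_def by blast+
    then show ?thesis
      by (simp add: scaleR_fun_def fun_eq_iff)
  qed
  moreover have "(a *\<^sub>R D + b *\<^sub>R D') Xs z \<in> smooth_sections E \<and>
      (\<forall>i<p. alternating_multilinear_on (smooth_sections E) (n - 1)
         (\<lambda>X. (a *\<^sub>R D + b *\<^sub>R D') (Xs[i := X]) z)) \<and>
      alternating_multilinear_on (smooth_sections E) n
         (\<lambda>ys. (a *\<^sub>R D + b *\<^sub>R D') (Xs[p - 1 := butlast ys]) (last ys))"
    if "Xs \<in> blocks n E p" "z \<in> smooth_sections E" for Xs z
  proof -
    have app: "(a *\<^sub>R D + b *\<^sub>R D') Ys w = a *\<^sub>R D Ys w + b *\<^sub>R D' Ys w" for Ys w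
      by (simp add: scaleR_fun_def)
    have "D Xs z \<in> smooth_sections E" "D' Xs z \<in> smooth_sections E"
      using D D' that unfolding Der_def by blast+
    then have "a *\<^sub>R D Xs z + b *\<^sub>R D' Xs z \<in> smooth_sections E"
      using assms(2) by (intro subspace_add subspace_scale)
    moreover have "\<forall>i<p. alternating_multilinear_on (smooth_sections E) (n - 1) (\<lambda>X. D (Xs[i := X]) z)"
      "\<forall>i<p. alternating_multilinear_on (smooth_sections E) (n - 1) (\<lambda>X. D' (Xs[i := X]) z)"
      "alternating_multilinear_on (smooth_sections E) n (\<lambda>ys. D (Xs[p - 1 := butlast ys]) (last ys))"
      "alternating_multilinear_on (smooth_sections E) n (\<lambda>ys. D' (Xs[p - 1 := butlast ys]) (last ys))"
      using D D' that unfolding Der_def by blast+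
    ultimately show ?thesis
      unfolding app by (simp add: alternating_multilinear_on_linear_combination)
  qed
  ultimately show ?thesis
    unfolding Der_def by blast
qed

section \<open>Linearity and symmetry of the bracket\<close>

lemma Der_linear_in_block:
  assumes "D \<in> Der n E p" "Xs \<in> blocks n E p" "z \<in> smooth_sections E" "i < p" "j < n - 1"
    and "x \<in> smooth_sections E" "y \<in> smooth_sections E"
  shows "D (Xs[i := (Xs ! i)[j := a *\<^sub>R x + b *\<^sub>R y]]) z =
    a *\<^sub>R D (Xs[i := (Xs ! i)[j := x]]) z + b *\<^sub>R D (Xs[i := (Xs ! i)[j := y]]) z"
proof -
  have "alternating_multilinear_on (smooth_sections E) (n - 1) (\<lambda>X. D (Xs[i := X]) z)"
    using assms(1-4) unfolding Der_def by blast
  moreover have "length (Xs ! i) = n - 1" "set (Xs ! i) \<subseteq> smooth_sections E"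
    using assms(2,4) by (auto simp: blocks_def)
  ultimately show ?thesis
    using assms(5-7) unfolding alternating_multilinear_on_def by blast
qed

text \<open>\<open>Der\<close> asks for linearity in the final section only through the joint
  condition on the last block and that section, taken as one list of \<open>n\<close> arguments;
  \<open>p \<ge> 1\<close> provides the last block.\<close>

lemma Der_linear_in_section:
  assumes "n \<ge> 1" "p \<ge> 1" "D \<in> Der n E p" "Xs \<in> blocks n E p"
    and "x \<in> smooth_sections E" "y \<in> smooth_sections E"
  shows "D Xs (a *\<^sub>R x + b *\<^sub>R y) = a *\<^sub>R D Xs x + b *\<^sub>R D Xs y"
proof -
  define F where "F = (\<lambda>ys. D (Xs[p - 1 := butlast ys]) (last ys))"
  define ys where "ys = Xs ! (p - 1) @ [x]"
  have "p - 1 < length Xs"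
    using assms(2,4) by (simp add: blocks_def)
  then have block: "length (Xs ! (p - 1)) = n - 1" "set (Xs ! (p - 1)) \<subseteq> smooth_sections E"
    using assms(4) by (auto simp: blocks_def)
  have "alternating_multilinear_on (smooth_sections E) n F"
    using assms(3-5) unfolding Der_def F_def by blast
  moreover have "length ys = n" "set ys \<subseteq> smooth_sections E" "n - 1 < n"
    using block assms(1,5) by (auto simp: ys_def)
  ultimately have "F (ys[n - 1 := a *\<^sub>R x + b *\<^sub>R y]) = a *\<^sub>R F (ys[n - 1 := x]) + b *\<^sub>R F (ys[n - 1 := y])"
    using assms(5,6) unfolding alternating_multilinear_on_def by blast
  \<comment> \<open>Position \<open>n - 1\<close> of \<open>ys\<close> is the appended section, so
    \<open>butlast\<close> returns the original last block and \<open>Xs\<close> is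
    restored.\<close>
  moreover have "F (ys[n - 1 := w]) = D Xs w" for w
    using block by (simp add: F_def ys_def list_update_append)
  ultimately show ?thesis
    by simp
qed

text \<open>The inner map occurs once in each term, in a single argument of \<open>D\<close>: an
  entry of a block if \<open>k < p\<close>, the final section if \<open>k = p\<close>. Linearity of
  \<open>D\<close> there suffices, but \<open>Der\<close> grants it only for arguments that are
  smooth sections, so most of the proof checks this.\<close>

lemma comp_at_linear_right:
  assumes "n \<ge> 1" "p \<ge> 1" "k \<le> p" "\<sigma> \<in> Sh k q"
    and D: "D \<in> Der n E p" and G: "G \<in> Der n E q" and H: "H \<in> Der n E q"
    and Xs: "Xs \<in> blocks n E (p + q)" and z: "z \<in> smooth_sections E"
  shows "comp_at n p q k \<sigma> D (a *\<^sub>R G + b *\<^sub>R H) Xs z =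
    a *\<^sub>R comp_at n p q k \<sigma> D G Xs z + b *\<^sub>R comp_at n p q k \<sigma> D H Xs z"
proof -
  define front where "front = map (\<lambda>i. Xs ! \<sigma> i) [0..<k]"
  define inner where "inner = map (\<lambda>i. Xs ! \<sigma> i) [k..<k + q]"
  define rest where "rest = drop (k + q + 1) Xs"
  have len: "length Xs = p + q"
    using Xs by (simp add: blocks_def)
  \<comment> \<open>The shuffle moves only the first \<open>k + q\<close> indices, and
    \<open>k \<le> p\<close> keeps these within the \<open>p + q\<close> blocks of
    \<open>Xs\<close>.\<close>
  have perm: "\<sigma> i < k + q" if "i < k + q" for i
    using \<open>\<sigma> \<in> Sh k q\<close> that permutes_in_image[of \<sigma> "{..<k + q}" i] by (simp add: Sh_def)
  have nth: "length (Xs ! i) = n - 1 \<and> set (Xs ! i) \<subseteq> smooth_sections E" if "i < p + q" for i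
    using Xs that by (simp add: blocks_def)
  have nth_perm: "length (Xs ! \<sigma> i) = n - 1 \<and> set (Xs ! \<sigma> i) \<subseteq> smooth_sections E" if "i < k + q" for i
    using nth perm[OF that] \<open>k \<le> p\<close> by (meson add_right_mono less_le_trans)
  have inner: "inner \<in> blocks n E q"
    using nth_perm unfolding blocks_def inner_def by auto
  have sec: "G inner w \<in> smooth_sections E" "H inner w \<in> smooth_sections E"
    if "w \<in> smooth_sections E" for w
    using inner G H that unfolding Der_def by blast+
  have app: "(a *\<^sub>R G + b *\<^sub>R H) inner w = a *\<^sub>R G inner w + b *\<^sub>R H inner w" for w
    by (simp add: scaleR_fun_def)
  show ?thesis
  proof (cases "k < p")
    case True
    define B where "B = Xs ! (k + q)"
    \<comment> \<open>The arguments of \<open>D\<close> with block \<open>k + q\<close> of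
      \<open>Xs\<close> left unmodified. It sits at position \<open>k\<close>, so inserting the
      inner value becomes an update of one entry of one block of \<open>Ys\<close>.\<close>
    define Ys where "Ys = front @ [B] @ rest"
    have Bn: "length B = n - 1" "set B \<subseteq> smooth_sections E"
      using nth[of "k + q"] True by (auto simp: B_def)
    have "set rest \<subseteq> set Xs"
      unfolding rest_def by (rule set_drop_subset)
    then have rest: "length X = n - 1 \<and> set X \<subseteq> smooth_sections E" if "X \<in> set rest" for X
      using Xs that by (auto simp: blocks_def)
    have front: "length X = n - 1 \<and> set X \<subseteq> smooth_sections E" if "X \<in> set front" for X
    proof -
      from that obtain i where "i < k" "X = Xs ! \<sigma> i"
        by (auto simp: front_def)
      then show ?thesis
        using nth_perm[of i] by simp
    qed
    have Ys: "Ys \<in> blocks n E p"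
      using front rest Bn True len by (auto simp: blocks_def Ys_def front_def rest_def)
    have upd: "front @ [C] @ rest = Ys[k := C]" and Ysk: "Ys ! k = B" for C
      by (simp_all add: Ys_def front_def list_update_append nth_append)
    have "D (front @ [B[s := (a *\<^sub>R G + b *\<^sub>R H) inner (B ! s)]] @ rest) z =
        a *\<^sub>R D (front @ [B[s := G inner (B ! s)]] @ rest) z +
        b *\<^sub>R D (front @ [B[s := H inner (B ! s)]] @ rest) z" if "s < n - 1" for s
    proof -
      have "B ! s \<in> smooth_sections E"
        using Bn that by auto
      then show ?thesis
        unfolding upd app
        using Der_linear_in_block[OF D Ys z True that sec, unfolded Ysk] by blast
    qed
    \<comment> \<open>The sign and the sum over \<open>s\<close> are themselves linear.\<close>
    then show ?thesis
      using True
      unfolding comp_at_def Let_def front_def[symmetric] inner_def[symmetric] rest_def[symmetric]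
        B_def[symmetric]
      by (simp add: sum.distrib scaleR_sum_right[symmetric] scaleR_add_right mult.commute)
  next
    case False
    then have "k = p"
      using \<open>k \<le> p\<close> by simp
    then have "front \<in> blocks n E p"
      using nth_perm unfolding blocks_def front_def by auto
    then have "D front ((a *\<^sub>R G + b *\<^sub>R H) inner z) =
        a *\<^sub>R D front (G inner z) + b *\<^sub>R D front (H inner z)"
      unfolding app using Der_linear_in_section[OF assms(1,2) D _ sec] z by blast
    then show ?thesis
      using False
      unfolding comp_at_def Let_def front_def[symmetric] inner_def[symmetric]
      by (simp add: scaleR_add_right mult.commute)
  qed
qed

lemma circ_linear_right:
  assumes "n \<ge> 1" "p \<ge> 1" "D \<in> Der n E p" "G \<in> Der n E q" "H \<in> Der n E q"
  shows "circ n E p q D (a *\<^sub>R G + b *\<^sub>R H) = a *\<^sub>R circ n E p q D G + b *\<^sub>R circ n E p q D H"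
proof (intro ext)
  fix Xs z m
  have "circ n E p q D (a *\<^sub>R G + b *\<^sub>R H) Xs z = a *\<^sub>R circ n E p q D G Xs z + b *\<^sub>R circ n E p q D H Xs z"
  proof (cases "Xs \<in> blocks n E (p + q) \<and> z \<in> smooth_sections E")
    case True
    then show ?thesis
      using comp_at_linear_right[OF assms(1,2) _ _ assms(3-5)]
      by (simp add: circ_def scaleR_sum_right sum.distrib scaleR_add_right mult.commute)
  next
    case False
    then show ?thesis
      by (auto simp: circ_def)
  qed
  then show "circ n E p q D (a *\<^sub>R G + b *\<^sub>R H) Xs z m =
      (a *\<^sub>R circ n E p q D G + b *\<^sub>R circ n E p q D H) Xs z m"
    by (simp add: scaleR_fun_def)
qed

text \<open>The left factor is the outermost map of every term, so pointwise addition and scaling of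
  maps give the claim directly.\<close>

lemma circ_linear_left:
  "circ n E p q (a *\<^sub>R G + b *\<^sub>R H) D = a *\<^sub>R circ n E p q G D + b *\<^sub>R circ n E p q H D"
proof (intro ext)
  fix Xs z m
  have app: "(a *\<^sub>R G + b *\<^sub>R H) Ys w = a *\<^sub>R G Ys w + b *\<^sub>R H Ys w" for Ys w
    by (simp add: scaleR_fun_def)
  have "comp_at n p q k \<sigma> (a *\<^sub>R G + b *\<^sub>R H) D Xs z =
      a *\<^sub>R comp_at n p q k \<sigma> G D Xs z + b *\<^sub>R comp_at n p q k \<sigma> H D Xs z" for k \<sigma>
    unfolding comp_at_def Let_def app
    by (simp add: sum.distrib scaleR_sum_right[symmetric] scaleR_add_right mult.commute)
  then have "circ n E p q (a *\<^sub>R G + b *\<^sub>R H) D Xs z = a *\<^sub>R circ n E p q G D Xs z + b *\<^sub>R circ n E p q H D Xs z"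
    by (simp add: circ_def scaleR_sum_right sum.distrib scaleR_add_right mult.commute)
  then show "circ n E p q (a *\<^sub>R G + b *\<^sub>R H) D Xs z m =
      (a *\<^sub>R circ n E p q G D + b *\<^sub>R circ n E p q H D) Xs z m"
    by (simp add: scaleR_fun_def)
qed

text \<open>The varying argument is the inner map in one composition and the outer map in the other,
  so both linearity results on \<open>circ\<close> enter.\<close>

lemma der_bracket_linear_right:
  assumes "n \<ge> 1" "p \<ge> 1" "D \<in> Der n E p" "G \<in> Der n E q" "H \<in> Der n E q"
  shows "der_bracket n E p q D (a *\<^sub>R G + b *\<^sub>R H) = a *\<^sub>R der_bracket n E p q D G + b *\<^sub>R der_bracket n E p q D H"
  by (simp add: der_bracket_def circ_linear_right[OF assms] circ_linear_left algebra_simps)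

text \<open>For \<open>p = q = 1\<close> the sign is -1, and the bracket is minus the sum of the
  compositions in both orders.\<close>

lemma der_bracket_commute_degree_1: "der_bracket n E 1 1 D G = der_bracket n E 1 1 G D"
  by (simp add: der_bracket_def)

section \<open>The space of coboundaries and the trivial class\<close>

text \<open>The coboundaries are the image of the cochains under \<open>delta_F\<close>. Linearity
  of \<open>delta_F\<close> is available on cochains, not on all maps, so closure is shown through
  preimages in \<open>Der\<close>.\<close>

lemma subspace_coboundaries:
  assumes "n \<ge> 1" "smooth_atlas (atlas E)" "subspace (smooth_sections E)" "\<phi> \<in> Der n E 1"
    and "C_F n E (k - 1) \<noteq> {}"
  shows "subspace (coboundaries n E \<phi> k)"
proof -
  have comb: "a *\<^sub>R x + b *\<^sub>R y \<in> coboundaries n E \<phi> k"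
    if "x \<in> coboundaries n E \<phi> k" "y \<in> coboundaries n E \<phi> k" for a b x y
  proof -
    obtain G H where GH: "G \<in> Der n E (k - 1 - 1)" "H \<in> Der n E (k - 1 - 1)"
      and xy: "x = delta_F n E \<phi> (k - 1) G" "y = delta_F n E \<phi> (k - 1) H"
      using \<open>x \<in> _\<close> \<open>y \<in> _\<close> unfolding coboundaries_def C_F_def by blast
    have "a *\<^sub>R x + b *\<^sub>R y = delta_F n E \<phi> (k - 1) (a *\<^sub>R G + b *\<^sub>R H)"
      using der_bracket_linear_right[OF assms(1) order_refl assms(4) GH] by (simp add: xy delta_F_def)
    moreover have "a *\<^sub>R G + b *\<^sub>R H \<in> C_F n E (k - 1)"
      using Der_linear_combination[OF assms(2,3) GH] by (simp add: C_F_def)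
    ultimately show ?thesis
      unfolding coboundaries_def by blast
  qed
  \<comment> \<open>Some coboundary exists, and zero is its trivial combination with itself.\<close>
  obtain x where "x \<in> coboundaries n E \<phi> k"
    using assms(5) unfolding coboundaries_def by blast
  then show ?thesis
    using comb[of x x 0 0] comb[of _ _ 1 1] comb[of _ _ _ 0] by (simp add: subspace_def)
qed

text \<open>The unit of the quotient is the set of coboundaries itself and the class of
  \<open>\<psi>\<close> is its translate by \<open>\<psi>\<close>. A subspace equals such a
  translate exactly if it contains the translating vector.\<close>

lemma cohomology_class_eq_one_iff:
  assumes "subspace (coboundaries n E \<phi> k)"
  shows "cohomology_class n E \<phi> k \<psi> = \<one>\<^bsub>H_F n E \<phi> k\<^esub> \<longleftrightarrow> \<psi> \<in> coboundaries n E \<phi> k"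
proof -
  let ?B = "coboundaries n E \<phi> k"
  have "cohomology_class n E \<phi> k \<psi> = (\<lambda>h. h + \<psi>) ` ?B" "\<one>\<^bsub>H_F n E \<phi> k\<^esub> = ?B"
    by (auto simp: cohomology_class_def r_coset_def cocycles_def H_F_def FactGroup_def)
  \<comment> \<open>\<open>\<psi>\<close> is the translate of 0.\<close>
  moreover have "\<psi> \<in> ?B" if "(\<lambda>h. h + \<psi>) ` ?B = ?B"
    using that subspace_0[OF assms] by (metis add_0 image_eqI)
  moreover have "(\<lambda>h. h + \<psi>) ` ?B = ?B" if "\<psi> \<in> ?B"
  proof
    show "(\<lambda>h. h + \<psi>) ` ?B \<subseteq> ?B"
      using subspace_add[OF assms _ that] by blast
    show "?B \<subseteq> (\<lambda>h. h + \<psi>) ` ?B"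
    proof
      show "x \<in> (\<lambda>h. h + \<psi>) ` ?B" if "x \<in> ?B" for x
        using subspace_diff[OF assms that \<open>\<psi> \<in> ?B\<close>] by (intro image_eqI[of _ _ "x - \<psi>"]) simp_all
    qed
  qed
  ultimately show ?thesis
    by auto
qed

section \<open>The equation for the new coefficient\<close>

lemma sum_top_degree:
  fixes \<Phi> :: "nat \<Rightarrow> ('m, 'v::real_vector) cochain"
  shows "(\<Sum>(i, j)\<in>{(i, j). i + j = k + 1}.
      der_bracket n E 1 1 ((\<Phi>(k + 1 := \<psi>)) i) ((\<Phi>(k + 1 := \<psi>)) j)) =
    2 *\<^sub>R (der_bracket n E 1 1 (\<Phi> 0) \<psi> - Theta_F n E k \<Phi>)"
proof -
  let ?P = "{(i, j). i + j = k + 1 \<and> i > 0 \<and> j > 0}"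
  let ?f = "\<lambda>\<Phi> (i, j). der_bracket n E 1 1 (\<Phi> i) (\<Phi> j)"
  \<comment> \<open>Only the two pairs with a zero index reach the new coefficient
    \<open>\<psi>\<close>. They are distinct since \<open>k + 1\<close> is nonzero, and for the same
    reason the update leaves \<open>\<Phi> 0\<close> alone.\<close>
  have split: "{(i, j). i + j = k + 1} = insert (0, k + 1) (insert (k + 1, 0) ?P)"
    by auto
  have "?P \<subseteq> {..k + 1} \<times> {..k + 1}"
    by auto
  then have fin: "finite ?P"
    by (rule finite_subset) simp
  \<comment> \<open>Positive indices with sum \<open>k + 1\<close> are at most \<open>k\<close>, so
    the update is not seen.\<close>
  have inner: "(\<Sum>x\<in>?P. ?f (\<Phi>(k + 1 := \<psi>)) x) = (\<Sum>x\<in>?P. ?f \<Phi> x)"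
    by (rule sum.cong) auto
  have "(\<Sum>x\<in>{(i, j). i + j = k + 1}. ?f (\<Phi>(k + 1 := \<psi>)) x) =
      der_bracket n E 1 1 (\<Phi> 0) \<psi> + (der_bracket n E 1 1 \<psi> (\<Phi> 0) + (\<Sum>x\<in>?P. ?f \<Phi> x))"
    unfolding split using fin inner by simp
  \<comment> \<open>By symmetry both outer pairs contribute the same bracket; by the factor -1/2 in
    \<open>Theta_F\<close>, the sum over \<open>?P\<close> is -2 times the obstruction.\<close>
  also have "\<dots> = 2 *\<^sub>R (der_bracket n E 1 1 (\<Phi> 0) \<psi> - Theta_F n E k \<Phi>)"
    unfolding der_bracket_commute_degree_1[of n E \<psi> "\<Phi> 0"]
    by (simp add: Theta_F_def scaleR_2 algebra_simps)
  finally show ?thesis .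
qed

text \<open>The equations up to degree \<open>k\<close> involve old coefficients only and hold
  already; the one new condition is that of degree \<open>k + 1\<close>, given by
  \<open>sum_top_degree\<close>.\<close>

lemma deformation_Suc_iff:
  assumes "deformation n E \<phi> k \<Phi>" "\<psi> \<in> Der n E 1"
  shows "deformation n E \<phi> (k + 1) (\<Phi>(k + 1 := \<psi>)) \<longleftrightarrow> Theta_F n E k \<Phi> = delta_F n E \<phi> 2 \<psi>"
proof -
  let ?\<Psi> = "\<Phi>(k + 1 := \<psi>)"
  let ?sum = "\<lambda>\<Phi> r. \<Sum>(i, j)\<in>{(i, j). i + j = r}. der_bracket n E 1 1 (\<Phi> i) (\<Phi> j)"
  have "?sum ?\<Psi> r = ?sum \<Phi> r" if "r \<le> k" for r
    using that by (intro sum.cong) auto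
  then have low: "?sum ?\<Psi> r = 0" if "r \<le> k" for r
    using assms(1) that by (simp add: deformation_def)
  have "deformation n E \<phi> (k + 1) ?\<Psi> \<longleftrightarrow> ?sum ?\<Psi> (k + 1) = 0"
    using assms low unfolding deformation_def by (auto simp: le_Suc_eq)
  also have "\<dots> \<longleftrightarrow> Theta_F n E k \<Phi> = delta_F n E \<phi> 2 \<psi>"
    unfolding sum_top_degree using assms(1) by (auto simp: deformation_def delta_F_def)
  finally show ?thesis .
qed

theorem theorem5p10:
  fixes E :: "('m::{t2_space,second_countable_topology}, 'e::real_normed_vector,
               'v::real_vector, 'r::real_normed_vector) vector_bundle"
    and n k :: nat
    and br :: "('m \<Rightarrow> 'v) list \<Rightarrow> ('m \<Rightarrow> 'v)"
    and a :: "'m \<Rightarrow> 'v list \<Rightarrow> ('m \<Rightarrow> real) \<Rightarrow> real"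
    and \<phi> :: "('m, 'v) cochain"
    and \<Phi> :: "nat \<Rightarrow> ('m, 'v) cochain"
  assumes "n \<ge> 2"
    and "smooth_vector_bundle E"
    and "filippov_algebroid n E br a"
    and "\<phi> = structure_cochain n E br"
    and "deformation n E \<phi> k \<Phi>"
  shows "extends_deformation n E \<phi> k \<Phi> \<longleftrightarrow>
         cohomology_class n E \<phi> 3 (Theta_F n E k \<Phi>) = \<one>\<^bsub>H_F n E \<phi> 3\<^esub>"
proof -
  have atlas: "smooth_atlas (atlas E)"
    using assms(2) by (simp add: smooth_vector_bundle_def)
  have sections: "subspace (smooth_sections E)"
    using assms(3) by (simp add: filippov_algebroid_def filippov_algebra_on_def)
  have "\<phi> \<in> Der n E 1"
    using assms(5) by (auto simp: deformation_def)
  \<comment> \<open>Degree-2 cochains are \<open>Der n E 1\<close>, which contains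
    \<open>\<phi>\<close> itself.\<close>
  moreover from this have "C_F n E (3 - 1) \<noteq> {}"
    by (auto simp: C_F_def)
  ultimately have "subspace (coboundaries n E \<phi> 3)"
    using atlas sections assms(1) by (intro subspace_coboundaries) simp_all
  then have "cohomology_class n E \<phi> 3 (Theta_F n E k \<Phi>) = \<one>\<^bsub>H_F n E \<phi> 3\<^esub> \<longleftrightarrow>
      Theta_F n E k \<Phi> \<in> coboundaries n E \<phi> 3"
    by (rule cohomology_class_eq_one_iff)
  \<comment> \<open>Both sides now range over the same \<open>\<psi>\<close>, since
    \<open>C_F n E 2\<close> is \<open>Der n E 1\<close> and coboundaries of degree 3 are values of
    \<open>delta_F\<close> in degree 2.\<close>
  then show ?thesis
    using deformation_Suc_iff[OF assms(5)]
    by (auto simp: extends_deformation_def coboundaries_def C_F_def)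
qed

end
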